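(* Let $\lambda/\mu$ be a skew shape with $n$ cells which is not a connected ribbon, and let $(\mathrm{cDes},p)$ be any cyclic extension of the descent map $\mathrm{Des}$ on $\mathrm{SYT}(\lambda/\mu)$. Then \[ n\, s_{\lambda/\mu}=\sum_{T\in\mathrm{SYT}(\lambda/\mu)}F^{\mathrm{cyc}}_{n,\mathrm{cDes}(T)}, \] where $s_{\lambda/\mu}$ is the skew Schur function.
   Context: A ribbon is a skew shape containing no $2\times2$ square. $\mathrm{SYT}(\lambda/\mu)$ is the set of standard Young tableaux of shape $\lambda/\mu$; for such $T$, $\mathrm{Des}(T)=\{1\le i\le n-1: i+1 \text{ appears in a lower row of } T \text{ than } i\}$. For a finite set $\mathcal T$ with a map $\mathrm{Des}:\mathcal T\to 2^{[n-1]}$ ($n>1$), a cyclic extension is a pair $(\mathrm{cDes},p)$ of a map $\mathrm{cDes}:\mathcal T\to2^{[n]}$ and a bijection $p:\mathcal T\to\mathcal T$ such that for all $T$: $\mathrm{cDes}(T)\cap[n-1]=\mathrm{Des}(T)$; $\mathrm{cDes}(p(T))=1+\mathrm{cDes}(T)$ (mod $n$); and $\varnothing\subsetneq\mathrm{cDes}(T)\subsetneq[n]$. For $J\subseteq[n]$, let $P^{\mathrm{cyc}}_{n,J}$ be the set of pairs $(w,k)$ with $w\in\{1,2,\dots\}^n$, $k\in[n]$, such that (i) $w_k\le w_{k+1}\le\cdots\le w_n\le w_1\le\cdots\le w_{k-1}$, and (ii) $w_j<w_{j+1}$ for every $j\in J\setminus\{k-1\}$, indices modulo $n$. Define $F^{\mathrm{cyc}}_{n,J}:=\sum_{(w,k)\in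 P^{\mathrm{cyc}}_{n,J}}x_{w_1}\cdots x_{w_n}$. *)

theory Defs
  imports Main "HOL-Library.FuncSet" "HOL-Library.Multiset"
begin

(* The parts are lam 0, lam 1, ..., so rows and columns of diagrams are numbered from 0
   (entries of tableaux are numbered from 1).  Row i + 1 lies below row i. *)
definition is_partition :: "(nat \<Rightarrow> nat) \<Rightarrow> bool" where
  "is_partition lam \<longleftrightarrow> antimono lam \<and> finite {i. lam i \<noteq> 0}"

type_synonym cell = "nat \<times> nat"

definition skew_shape :: "(nat \<Rightarrow> nat) \<Rightarrow> (nat \<Rightarrow> nat) \<Rightarrow> cell set" where
  "skew_shape lam mu = {(i, j). mu i \<le> j \<and> j < lam i}"

definition ribbon :: "cell set \<Rightarrow> bool" where
  "ribbon D \<longleftrightarrow>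
     \<not> (\<exists>i j. {(i, j), (i, Suc j), (Suc i, j), (Suc i, Suc j)} \<subseteq> D)"

fun adjacent :: "cell \<Rightarrow> cell \<Rightarrow> bool" where
  "adjacent (i, j) (i', j') \<longleftrightarrow>
     i = i' \<and> (j' = Suc j \<or> j = Suc j') \<or> j = j' \<and> (i' = Suc i \<or> i = Suc i')"

definition connected_shape :: "cell set \<Rightarrow> bool" where
  "connected_shape D \<longleftrightarrow>
     (\<forall>c\<in>D. \<forall>d\<in>D. (c, d) \<in> {(a, b). a \<in> D \<and> b \<in> D \<and> adjacent a b}\<^sup>*)"

definition SYT :: "cell set \<Rightarrow> (cell \<Rightarrow> nat) set" where
  "SYT D = {T \<in> extensional D. bij_betw T D {1..card D} \<and>
     (\<forall>i j j'. (i, j) \<in> D \<and> (i, j') \<in> D \<and> j < j' \<longrightarrow> T (i, j) < T (i, j')) \<and>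
     (\<forall>i i' j. (i, j) \<in> D \<and> (i', j) \<in> D \<and> i < i' \<longrightarrow> T (i, j) < T (i', j))}"

definition SSYT :: "cell set \<Rightarrow> (cell \<Rightarrow> nat) set" where
  "SSYT D = {T \<in> D \<rightarrow>\<^sub>E {1..}.
     (\<forall>i j j'. (i, j) \<in> D \<and> (i, j') \<in> D \<and> j < j' \<longrightarrow> T (i, j) \<le> T (i, j')) \<and>
     (\<forall>i i' j. (i, j) \<in> D \<and> (i', j) \<in> D \<and> i < i' \<longrightarrow> T (i, j) < T (i', j))}"

definition Des :: "cell set \<Rightarrow> (cell \<Rightarrow> nat) \<Rightarrow> nat set" where
  "Des D T = {i \<in> {1..card D - 1}.
     \<exists>c\<in>D. \<exists>d\<in>D. T c = i \<and> T d = i + 1 \<and> fst c < fst d}"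

text \<open>Addition and subtraction of 1 modulo \<open>n\<close> on the residues \<open>1, \<dots>, n\<close>.\<close>

definition cyc_suc :: "nat \<Rightarrow> nat \<Rightarrow> nat" where
  "cyc_suc n j = (if j = n then 1 else j + 1)"

definition cyc_pred :: "nat \<Rightarrow> nat \<Rightarrow> nat" where
  "cyc_pred n j = (if j = 1 then n else j - 1)"

definition cyclic_extension ::
  "nat \<Rightarrow> 'a set \<Rightarrow> ('a \<Rightarrow> nat set) \<Rightarrow> ('a \<Rightarrow> nat set) \<Rightarrow> ('a \<Rightarrow> 'a) \<Rightarrow> bool" where
  "cyclic_extension n A D cD p \<longleftrightarrow>
     n > 1 \<and> bij_betw p A A \<and>
     (\<forall>T\<in>A. cD T \<inter> {1..n - 1} = D T \<and>
            cD (p T) = cyc_suc n ` cD T \<and>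
            {} \<subset> cD T \<and> cD T \<subset> {1..n})"

text \<open>
  A formal power series in \<open>x\<^sub>1, x\<^sub>2, \<dots>\<close> is its coefficient function; the monomial
  \<open>x\<^bsub>a\<^esub> x\<^bsub>b\<^esub> \<dots>\<close> is the multiset \<open>{#a, b, \<dots>#}\<close> of its indices.
  \<open>gen_series A wt\<close> is the sum of the monomials \<open>wt a\<close> over \<open>a \<in> A\<close>; it is meaningful only if
  every monomial occurs finitely often (see \<open>finite_SSYT_fibre\<close>, \<open>finite_Pcyc_fibre\<close> below).
\<close>

type_synonym power_series = "nat multiset \<Rightarrow> int"

definition gen_series :: "'a set \<Rightarrow> ('a \<Rightarrow> nat multiset) \<Rightarrow> power_series" where
  "gen_series A wt = (\<lambda>m. int (card {a \<in> A. wt a = m}))"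

definition skew_schur :: "(nat \<Rightarrow> nat) \<Rightarrow> (nat \<Rightarrow> nat) \<Rightarrow> power_series" where
  "skew_schur lam mu =
     gen_series (SSYT (skew_shape lam mu)) (\<lambda>T. image_mset T (mset_set (skew_shape lam mu)))"

text \<open>
  The chain \<open>w\<^sub>k \<le> \<dots> \<le> w\<^sub>n \<le> w\<^sub>1 \<le> \<dots> \<le> w\<^bsub>k-1\<^esub>\<close> consists of the cyclically consecutive
  inequalities \<open>w\<^sub>j \<le> w\<^bsub>j+1\<^esub>\<close> for all \<open>j\<close> except \<open>j = k - 1\<close>.
\<close>

definition Pcyc :: "nat \<Rightarrow> nat set \<Rightarrow> ((nat \<Rightarrow> nat) \<times> nat) set" where
  "Pcyc n J = {(w, k). w \<in> {1..n} \<rightarrow>\<^sub>E {1..} \<and> k \<in> {1..n} \<and>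
     (\<forall>j \<in> {1..n} - {cyc_pred n k}. w j \<le> w (cyc_suc n j)) \<and>
     (\<forall>j \<in> J - {cyc_pred n k}. w j < w (cyc_suc n j))}"

definition Fcyc :: "nat \<Rightarrow> nat set \<Rightarrow> power_series" where
  "Fcyc n J = gen_series (Pcyc n J) (\<lambda>(w, k). image_mset w (mset_set {1..n}))"

lemma finite_skew_shape:
  assumes "is_partition lam"
  shows "finite (skew_shape lam mu)"
proof (rule finite_subset)
  show "skew_shape lam mu \<subseteq> (SIGMA i:{i. lam i \<noteq> 0}. {..<lam i})"
    by (auto simp: skew_shape_def)
  show "finite (SIGMA i:{i. lam i \<noteq> 0}. {..<lam i})"
    using assms by (auto simp: is_partition_def)
qed

lemma finite_SYT:
  assumes "finite D"
  shows "finite (SYT D)"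
proof (rule finite_subset)
  show "SYT D \<subseteq> D \<rightarrow>\<^sub>E {1..card D}"
    unfolding SYT_def PiE_def bij_betw_def by blast
  show "finite (D \<rightarrow>\<^sub>E {1..card D})"
    using assms by (intro finite_PiE) auto
qed

lemma finite_SSYT_fibre:
  assumes "finite D"
  shows "finite {T \<in> SSYT D. image_mset T (mset_set D) = m}"
proof (rule finite_subset)
  show "{T \<in> SSYT D. image_mset T (mset_set D) = m} \<subseteq> D \<rightarrow>\<^sub>E set_mset m"
    using assms by (auto simp: SSYT_def PiE_def)
  show "finite (D \<rightarrow>\<^sub>E set_mset m)"
    using assms by (intro finite_PiE) auto
qed

lemma finite_Pcyc_fibre:
  "finite {a \<in> Pcyc n J. (case a of (w, k) \<Rightarrow> image_mset w (mset_set {1..n})) = m}"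
proof (rule finite_subset)
  show "{a \<in> Pcyc n J. (case a of (w, k) \<Rightarrow> image_mset w (mset_set {1..n})) = m}
      \<subseteq> ({1..n} \<rightarrow>\<^sub>E set_mset m) \<times> {1..n}"
    by (auto simp: Pcyc_def PiE_def)
  show "finite (({1..n} \<rightarrow>\<^sub>E set_mset m) \<times> {1..n})"
    by (intro finite_cartesian_product finite_PiE) auto
qed

end

theory Submission
  imports Defs
begin

text \<open>
  Split \<open>Fcyc n J\<close> according to the position \<open>k\<close> where the chain starts. Rotating the word by
  one step turns start \<open>k\<close> into start \<open>k + 1\<close> and \<open>J\<close> into \<open>1 + J\<close>; since \<open>p\<close> is a bijection that
  acts on \<open>cDes\<close> in the same way, the sum over all tableaux of the part with start \<open>k\<close> does not
  depend on \<open>k\<close>. For \<open>k = 1\<close> the condition at \<open>n\<close> disappears, so that part is the sum of the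
  ordinary fundamental quasisymmetric functions of the sets \<open>Des T\<close>, which is the Schur
  function by standardization.
\<close>

text \<open>For \<open>J\<close> inside \<open>{1..n - 1}\<close> these are the words enumerated by
  the fundamental quasisymmetric function of \<open>J\<close>. They are extensional, so that a word
  is determined by its \<open>n\<close> letters.\<close>

definition compatible_words :: "nat \<Rightarrow> nat set \<Rightarrow> (nat \<Rightarrow> nat) set" where
  "compatible_words n J = {u \<in> {1..n} \<rightarrow>\<^sub>E {1..}.
     (\<forall>j \<in> {1..<n}. u j \<le> u (Suc j)) \<and> (\<forall>j \<in> J. u j < u (Suc j))}"

lemma compatible_words_mono:
  assumes u: "u \<in> compatible_words n J" and "1 \<le> a" "a \<le> b" "b \<le> n"
  shows "u a \<le> u b"
  using \<open>a \<le> b\<close> \<open>b \<le> n\<close>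
proof (induction b rule: dec_induct)
  case (step b)
  then have "u b \<le> u (Suc b)"
    using u \<open>1 \<le> a\<close> by (auto simp: compatible_words_def)
  with step show ?case by simp
qed simp

subsection \<open>Standardization\<close>

text \<open>Among cells with equal entries the reading order is from bottom to top, then left to right.\<close>

definition before :: "(cell \<Rightarrow> nat) \<Rightarrow> cell \<Rightarrow> cell \<Rightarrow> bool" where
  "before S c d \<longleftrightarrow> S c < S d \<or>
     S c = S d \<and> (fst d < fst c \<or> fst d = fst c \<and> snd c < snd d)"

lemma before_trans: "before S c d \<Longrightarrow> before S d e \<Longrightarrow> before S c e"
  unfolding before_def by auto

lemma before_irrefl: "\<not> before S c c"
  unfolding before_def by auto

lemma before_total: "c \<noteq> d \<Longrightarrow> before S c d \<or> before S d c"
  unfolding before_def by (auto simp: prod_eq_iff)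

text \<open>The rank of a cell in the strict total order \<open>before S\<close>; the disjunct
  \<open>d = c\<close> makes ranks start at 1.\<close>

definition standardize :: "cell set \<Rightarrow> (cell \<Rightarrow> nat) \<Rightarrow> cell \<Rightarrow> nat" where
  "standardize D S = restrict (\<lambda>c. card {d \<in> D. d = c \<or> before S d c}) D"

lemma standardize_less:
  assumes "finite D" "c \<in> D" "d \<in> D" "before S c d"
  shows "standardize D S c < standardize D S d"
proof -
  let ?A = "\<lambda>c. {e \<in> D. e = c \<or> before S e c}"
  have "?A c \<subseteq> ?A d"
    using assms(4) by (auto intro: before_trans)
  moreover have "d \<in> ?A d" "d \<notin> ?A c"
    using assms(3,4) before_trans before_irrefl by blast+
  ultimately have "?A c \<subset> ?A d" by blast
  then show ?thesis
    using assms by (auto simp: standardize_def intro: psubset_card_mono)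
qed

lemma standardize_less_iff:
  assumes "finite D" "c \<in> D" "d \<in> D"
  shows "standardize D S c < standardize D S d \<longleftrightarrow> before S c d"
  using assms standardize_less before_total by (metis less_asym less_irrefl)

lemma bij_betw_standardize:
  assumes "finite D"
  shows "bij_betw (standardize D S) D {1..card D}"
proof -
  have inj: "inj_on (standardize D S) D"
    using standardize_less[OF assms] before_total by (metis inj_onI less_irrefl)
  have "standardize D S c \<in> {1..card D}" if c: "c \<in> D" for c
  proof -
    have "card {c} \<le> card {d \<in> D. d = c \<or> before S d c}"
      using c assms by (intro card_mono) auto
    moreover have "card {d \<in> D. d = c \<or> before S d c} \<le> card D"
      using assms by (intro card_mono) auto
    ultimately show ?thesis using c by (simp add: standardize_def)
  qed
  then have "standardize D S ` D \<subseteq> {1..card D}" by auto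
  then have "standardize D S ` D = {1..card D}"
    using inj by (intro card_subset_eq) (auto simp: card_image)
  with inj show ?thesis by (simp add: bij_betw_def)
qed

text \<open>A bijection onto \<open>{1..card D}\<close> takes at \<open>c\<close> the number of
  cells whose value is at most \<open>T c\<close>. Distinct cells have comparable values and
  \<open>before S\<close> is asymmetric, so the one-way assumption \<open>less\<close> already gives
  an equivalence, and this number is the rank of \<open>c\<close>.\<close>

lemma standardize_unique:
  assumes T: "T \<in> extensional D" "bij_betw T D {1..card D}"
    and less: "\<And>c d. c \<in> D \<Longrightarrow> d \<in> D \<Longrightarrow> T c < T d \<Longrightarrow> before S c d"
  shows "T = standardize D S"
proof (rule extensionalityI[OF T(1)])
  show "standardize D S \<in> extensional D" by (simp add: standardize_def)
  fix c assume c: "c \<in> D"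
  have inj: "inj_on T D" and img: "T ` D = {1..card D}"
    using T(2) by (auto simp: bij_betw_def)
  have le: "d = c \<or> before S d c \<longleftrightarrow> T d \<le> T c" if "d \<in> D" for d
    using less[of c d] less[of d c] c that inj before_trans before_irrefl
    by (metis inj_onD le_less not_le)
  have "T c \<le> card D" using img c by auto
  then have "T ` {d \<in> D. T d \<le> T c} = {1..T c}"
    using img by (fastforce simp: set_eq_iff image_iff)
  then have "card {d \<in> D. T d \<le> T c} = T c"
    using card_image[of T "{d \<in> D. T d \<le> T c}"] inj
    by (metis (no_types, lifting) card_atLeastAtMost diff_Suc_1 inj_on_subset mem_Collect_eq subsetI)
  then show "T c = standardize D S c"
    using c le by (simp add: standardize_def cong: conj_cong)
qed

text \<open>Ties within a row are read from left to right and a column has no ties, so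
  \<open>before S\<close> orders the cells of each row and each column as a standard tableau
  requires.\<close>

lemma standardize_SYT:
  assumes "finite D" "S \<in> SSYT D"
  shows "standardize D S \<in> SYT D"
proof -
  have "before S (i, j) (i, j')" if "(i, j) \<in> D" "(i, j') \<in> D" "j < j'" for i j j'
    using assms(2) that by (auto simp: SSYT_def before_def le_less)
  moreover have "before S (i, j) (i', j)" if "(i, j) \<in> D" "(i', j) \<in> D" "i < i'" for i i' j
    using assms(2) that by (auto simp: SSYT_def before_def)
  ultimately show ?thesis
    using assms(1) bij_betw_standardize[OF assms(1), of S]
    by (auto simp: SYT_def standardize_less_iff) (simp add: standardize_def)
qed

section \<open>Inverting standardization\<close>

text \<open>The weakly increasing word \<open>u\<close> agrees at the ends of the interval from
  \<open>T c\<close> to \<open>T d\<close>, so it is constant there. A descent in between would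
  force a strict increase, hence passing from one value to the next never leads to a lower
  row.\<close>

lemma row_antimono_if_no_descent:
  assumes T: "T \<in> SYT D" and u: "u \<in> compatible_words (card D) (Des D T)"
    and "c \<in> D" "d \<in> D" "T c \<le> T d" "u (T c) = u (T d)"
  shows "fst d \<le> fst c"
proof -
  have bij: "bij_betw T D {1..card D}" using T by (simp add: SYT_def)
  then have inj: "inj_on T D" and img: "T ` D = {1..card D}"
    by (auto simp: bij_betw_def)
  have c1: "1 \<le> T c" and dn: "T d \<le> card D" using img assms(3,4) by auto
  have "\<forall>e\<in>D. T e = k \<longrightarrow> fst e \<le> fst c" if "T c \<le> k" "k \<le> T d" for k
    using that
  proof (induction k rule: dec_induct)
    case base
    then show ?case using inj assms(3) by (auto dest: inj_onD)
  next
    case (step k)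
    show ?case
    proof (intro ballI impI)
      fix e assume e: "e \<in> D" "T e = Suc k"
      have "k \<in> T ` D" using img step c1 dn by auto
      then obtain f where f: "f \<in> D" "T f = k" by auto
      have "u (T c) \<le> u k" "u (Suc k) \<le> u (T d)"
        using compatible_words_mono[OF u] step c1 dn by auto
      then have "\<not> u k < u (Suc k)" using assms(6) by simp
      then have "k \<notin> Des D T" using u by (auto simp: compatible_words_def)
      moreover have "k \<in> {1..card D - 1}" using step c1 dn by auto
      ultimately have "fst e \<le> fst f"
        using e f by (auto simp: Des_def not_less)
      also have "fst f \<le> fst c" using step f by auto
      finally show "fst e \<le> fst c" .
    qed
  qed
  from this[of "T d"] show ?thesis using assms by auto
qed

text \<open>The values of \<open>T\<close> must run through the cells in the reading order of the
  filling by \<open>u\<close>. Where \<open>u\<close> ties, the preceding lemma puts the later cell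
  weakly higher; if the rows agree, the increasing row of \<open>T\<close> puts it to the
  right.\<close>

lemma standardize_compose:
  assumes T: "T \<in> SYT D" and u: "u \<in> compatible_words (card D) (Des D T)"
  shows "standardize D (compose D u T) = T"
proof -
  have bij: "bij_betw T D {1..card D}" and ext: "T \<in> extensional D"
    using T by (auto simp: SYT_def)
  have "before (compose D u T) c d" if "c \<in> D" "d \<in> D" "T c < T d" for c d
  proof -
    have "T c \<ge> 1" "T d \<le> card D" using bij that by (auto simp: bij_betw_def)
    then have "u (T c) \<le> u (T d)"
      using compatible_words_mono[OF u] that by simp
    moreover have "fst d \<le> fst c" if "u (T c) = u (T d)"
      using row_antimono_if_no_descent[OF T u] that \<open>c \<in> D\<close> \<open>d \<in> D\<close> \<open>T c < T d\<close> by simp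
    moreover have "snd c < snd d" if "fst c = fst d"
    proof (rule ccontr)
      assume "\<not> snd c < snd d"
      with that have "c = d \<or> T d < T c"
        using T \<open>c \<in> D\<close> \<open>d \<in> D\<close> by (cases c; cases d) (auto simp: SYT_def not_less le_less)
      with \<open>T c < T d\<close> show False by auto
    qed
    ultimately show ?thesis
      using that by (auto simp: before_def compose_def)
  qed
  then show ?thesis using standardize_unique[OF ext bij] by metis
qed

lemma compose_SSYT:
  assumes T: "T \<in> SYT D" and u: "u \<in> compatible_words (card D) (Des D T)"
  shows "compose D u T \<in> SSYT D"
proof -
  have img: "T ` D = {1..card D}"
    using T by (auto simp: SYT_def bij_betw_def)
  have le: "u (T c) \<le> u (T d)" if "c \<in> D" "d \<in> D" "T c < T d" for c d
  proof -
    have "T c \<ge> 1" "T d \<le> card D" using img that by auto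
    then show ?thesis using compatible_words_mono[OF u] that by simp
  qed
  have "u (T c) \<ge> 1" if "c \<in> D" for c
  proof -
    have "T c \<in> {1..card D}" using img that by auto
    then show ?thesis using u by (auto simp: compatible_words_def)
  qed
  moreover have "u (T (i, j)) \<le> u (T (i, j'))"
    if "(i, j) \<in> D" "(i, j') \<in> D" "j < j'" for i j j'
    using T le that by (auto simp: SYT_def)
  moreover have "u (T (i, j)) < u (T (i', j))"
    if "(i, j) \<in> D" "(i', j) \<in> D" "i < i'" for i i' j
  proof -
    have less: "T (i, j) < T (i', j)" using T that by (auto simp: SYT_def)
    \<comment> \<open>A tie in a column would place the lower cell weakly above the upper
      one.\<close>
    have "u (T (i, j)) \<noteq> u (T (i', j))"
      using row_antimono_if_no_descent[OF T u that(1,2)] less that(3) by fastforce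
    then show ?thesis using le[OF that(1,2) less] by simp
  qed
  ultimately show ?thesis
    by (auto simp: SSYT_def compose_def)
qed

text \<open>The word lists the entries of \<open>S\<close> in reading order, hence weakly
  increasing. At a descent \<open>j\<close> the cell of \<open>j + 1\<close> is in a lower row, and
  a tie would have made it come earlier; so the increase is strict.\<close>

lemma destandardize_compatible:
  assumes fin: "finite D" and S: "S \<in> SSYT D"
  defines "T \<equiv> standardize D S"
  shows "compose {1..card D} S (inv_into D T) \<in> compatible_words (card D) (Des D T)"
proof -
  have bij: "bij_betw T D {1..card D}"
    unfolding T_def using bij_betw_standardize[OF fin] .
  then have inj: "inj_on T D" and img: "T ` D = {1..card D}"
    by (auto simp: bij_betw_def)
  let ?g = "inv_into D T"
  have g: "?g j \<in> D" "T (?g j) = j" if "j \<in> {1..card D}" for j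
    using that img by (auto intro: inv_into_into f_inv_into_f)
  have bef: "before S (?g j) (?g (Suc j))" if "1 \<le> j" "j < card D" for j
    using standardize_less_iff[OF fin, of "?g j" "?g (Suc j)" S] g[of j] g[of "Suc j"] that
    by (simp add: T_def)
  have "S (?g j) < S (?g (Suc j))" if j: "j \<in> Des D T" for j
  proof -
    from j obtain c d where cd: "c \<in> D" "d \<in> D" "T c = j" "T d = Suc j" "fst c < fst d"
      and j1: "1 \<le> j" "j \<le> card D - 1"
      by (auto simp: Des_def)
    then have "?g j = c" "?g (Suc j) = d"
      using inj by (metis inv_into_f_f)+
    moreover have "j < card D" using j1 by linarith
    ultimately show ?thesis using bef[of j] j1 cd by (auto simp: before_def)
  qed
  \<comment> \<open>For a descent \<open>j\<close>, both \<open>j\<close> and \<open>Suc j\<close>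
    are thus in the domain \<open>{1..card D}\<close> of \<open>compose\<close>.\<close>
  moreover have "Des D T \<subseteq> {1..<card D}"
    by (auto simp: Des_def)
  ultimately show ?thesis
    using bef g S
    by (fastforce simp: compatible_words_def compose_def SSYT_def before_def PiE_iff)
qed

text \<open>This is the coefficient of \<open>m\<close> in the expansion of the skew Schur function
  into fundamental quasisymmetric functions. A semistandard \<open>S\<close> corresponds to the pair
  of its standardization \<open>T\<close> and the word of its entries in the order given by
  \<open>T\<close>.\<close>

lemma card_SSYT_content:
  assumes fin: "finite D"
  shows "card {S \<in> SSYT D. image_mset S (mset_set D) = m} =
    (\<Sum>T\<in>SYT D. card {u \<in> compatible_words (card D) (Des D T).
       image_mset u (mset_set {1..card D}) = m})"
proof -
  let ?n = "card D"
  define C where "C = (\<lambda>T. {u \<in> compatible_words ?n (Des D T).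
       image_mset u (mset_set {1..?n}) = m})"
  \<comment> \<open>\<open>T\<close> only matches cells with positions, so filling the cells through
    \<open>T\<close> keeps the multiset of letters.\<close>
  have content: "image_mset (compose D u T) (mset_set D) = image_mset u (mset_set {1..?n})"
    if "T \<in> SYT D" for T u
  proof -
    have "image_mset (compose D u T) (mset_set D) = image_mset (u \<circ> T) (mset_set D)"
      using fin by (intro image_mset_cong) (simp add: compose_def)
    also have "\<dots> = image_mset u (mset_set (T ` D))"
      using that by (simp add: multiset.map_comp[symmetric] image_mset_mset_set SYT_def bij_betw_def)
    finally show ?thesis using that by (simp add: SYT_def bij_betw_def)
  qed
  have "bij_betw (\<lambda>(T, u). compose D u T) (Sigma (SYT D) C)
          {S \<in> SSYT D. image_mset S (mset_set D) = m}"
  proof (rule bij_betw_byWitness[where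
        f' = "\<lambda>S. (standardize D S, compose {1..?n} S (inv_into D (standardize D S)))"])
    show "\<forall>a\<in>Sigma (SYT D) C. (\<lambda>S. (standardize D S,
        compose {1..?n} S (inv_into D (standardize D S)))) ((\<lambda>(T, u). compose D u T) a) = a"
    proof (clarify, intro conjI)
      fix T u assume T: "T \<in> SYT D" and "u \<in> C T"
      then have u: "u \<in> compatible_words ?n (Des D T)" by (simp add: C_def)
      show std: "standardize D (compose D u T) = T"
        using standardize_compose[OF T u] .
      have "compose {1..?n} (compose D u T) (inv_into D T) j = u j" for j
      proof (cases "j \<in> {1..?n}")
        case True
        then have "j \<in> T ` D" using T by (simp add: SYT_def bij_betw_def)
        then show ?thesis
          using True by (simp add: compose_def inv_into_into f_inv_into_f)
      next
        \<comment> \<open>Outside \<open>{1..?n}\<close> both words have the value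
          \<open>undefined\<close>.\<close>
        case False
        then show ?thesis
          using u by (auto simp: compose_def compatible_words_def PiE_iff extensional_def)
      qed
      then show "compose {1..?n} (compose D u T)
          (inv_into D (standardize D (compose D u T))) = u"
        unfolding std by blast
    qed
    have inverse: "compose D (compose {1..?n} S (inv_into D (standardize D S))) (standardize D S) = S"
      if "S \<in> SSYT D" for S
    proof (rule extensionalityI)
      show "S \<in> extensional D" using that by (auto simp: SSYT_def PiE_iff)
      fix c assume "c \<in> D"
      then show "compose D (compose {1..?n} S (inv_into D (standardize D S))) (standardize D S) c = S c"
        using bij_betw_standardize[OF fin, of S]
        by (auto simp: compose_def bij_betw_def dest: inv_into_f_f)
    qed (simp add: compose_def)
    then show "\<forall>S\<in>{S \<in> SSYT D. image_mset S (mset_set D) = m}. (\<lambda>(T, u). compose D u T)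
        (standardize D S, compose {1..?n} S (inv_into D (standardize D S))) = S"
      by simp
    show "(\<lambda>(T, u). compose D u T) ` Sigma (SYT D) C
        \<subseteq> {S \<in> SSYT D. image_mset S (mset_set D) = m}"
      using compose_SSYT content by (auto simp: C_def)
    show "(\<lambda>S. (standardize D S, compose {1..?n} S (inv_into D (standardize D S)))) `
        {S \<in> SSYT D. image_mset S (mset_set D) = m} \<subseteq> Sigma (SYT D) C"
    proof clarify
      fix S assume S: "S \<in> SSYT D"
        and m: "m = image_mset S (mset_set D)"
      note T = standardize_SYT[OF fin S]
      show "standardize D S \<in> SYT D \<and>
          compose {1..?n} S (inv_into D (standardize D S)) \<in> C (standardize D S)"
        using T destandardize_compatible[OF fin S] m
          content[OF T, of "compose {1..?n} S (inv_into D (standardize D S))"]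
        unfolding inverse[OF S] C_def by simp
    qed
  qed
  then have "card {S \<in> SSYT D. image_mset S (mset_set D) = m} = card (Sigma (SYT D) C)"
    by (simp add: bij_betw_same_card)
  also have "\<dots> = (\<Sum>T\<in>SYT D. card (C T))"
  proof (rule card_SigmaI)
    show "finite (SYT D)" using finite_SYT[OF fin] .
    \<comment> \<open>Fixing the content leaves only finitely many letters to choose from.\<close>
    have "C T \<subseteq> {1..?n} \<rightarrow>\<^sub>E set_mset m" for T
      by (auto simp: C_def compatible_words_def PiE_def)
    then show "\<forall>T\<in>SYT D. finite (C T)"
      by (meson finite_PiE finite_atLeastAtMost finite_set_mset finite_subset)
  qed
  finally show ?thesis by (simp add: C_def)
qed

subsection \<open>Rotation\<close>

text \<open>Fixing both the start \<open>k\<close> and the content \<open>m\<close> gives finite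
  sets, so that coefficients can be compared as cardinalities.\<close>

definition cyc_words :: "nat \<Rightarrow> nat set \<Rightarrow> nat \<Rightarrow> nat multiset \<Rightarrow> (nat \<Rightarrow> nat) set" where
  "cyc_words n J k m = {w. (w, k) \<in> Pcyc n J \<and> image_mset w (mset_set {1..n}) = m}"

lemma finite_cyc_words: "finite (cyc_words n J k m)"
proof (rule finite_subset)
  show "cyc_words n J k m \<subseteq> {1..n} \<rightarrow>\<^sub>E set_mset m"
    by (auto simp: cyc_words_def Pcyc_def PiE_def)
qed (simp add: finite_PiE)

lemma Fcyc_eq_sum: "Fcyc n J m = (\<Sum>k\<in>{1..n}. int (card (cyc_words n J k m)))"
proof -
  have "{a \<in> Pcyc n J. (case a of (w, k) \<Rightarrow> image_mset w (mset_set {1..n})) = m}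
      = (\<lambda>(k, w). (w, k)) ` (SIGMA k:{1..n}. cyc_words n J k m)"
    by (auto simp: cyc_words_def Pcyc_def)
  then have "card {a \<in> Pcyc n J. (case a of (w, k) \<Rightarrow> image_mset w (mset_set {1..n})) = m}
      = card (SIGMA k:{1..n}. cyc_words n J k m)"
    by (simp add: card_image inj_on_def split_def prod_eq_iff)
  then show ?thesis
    by (simp add: Fcyc_def gen_series_def card_SigmaI finite_cyc_words)
qed

lemma cyc_suc_in: "j \<in> {1..n} \<Longrightarrow> cyc_suc n j \<in> {1..n}"
  by (auto simp: cyc_suc_def)

lemma cyc_pred_in: "j \<in> {1..n} \<Longrightarrow> cyc_pred n j \<in> {1..n}"
  by (auto simp: cyc_pred_def)

lemma cyc_pred_suc: "j \<in> {1..n} \<Longrightarrow> cyc_pred n (cyc_suc n j) = j"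
  by (auto simp: cyc_suc_def cyc_pred_def)

lemma cyc_suc_pred: "j \<in> {1..n} \<Longrightarrow> cyc_suc n (cyc_pred n j) = j"
  by (auto simp: cyc_suc_def cyc_pred_def)

lemma bij_betw_cyc_suc: "bij_betw (cyc_suc n) {1..n} {1..n}"
  by (rule bij_betw_byWitness[where f' = "cyc_pred n"])
    (auto simp: cyc_pred_suc cyc_suc_pred simp del: atLeastAtMost_iff One_nat_def
      intro: cyc_suc_in cyc_pred_in)

lemma bij_betw_cyc_pred: "bij_betw (cyc_pred n) {1..n} {1..n}"
  by (rule bij_betw_byWitness[where f' = "cyc_suc n"])
    (auto simp: cyc_pred_suc cyc_suc_pred simp del: atLeastAtMost_iff One_nat_def
      intro: cyc_suc_in cyc_pred_in)

lemma image_mset_compose_bij: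
  assumes "finite A" "bij_betw f A A"
  shows "image_mset (compose A w f) (mset_set A) = image_mset w (mset_set A)"
proof -
  have "image_mset (compose A w f) (mset_set A) = image_mset (w \<circ> f) (mset_set A)"
    using assms by (intro image_mset_cong) (simp add: compose_def)
  also have "\<dots> = image_mset w (mset_set (f ` A))"
    using assms by (simp add: multiset.map_comp[symmetric] image_mset_mset_set bij_betw_def)
  finally show ?thesis using assms by (simp add: bij_betw_def)
qed

text \<open>Rotation carries the comparison at \<open>j\<close> in \<open>w\<close> to the
  comparison at \<open>cyc_suc n j\<close> in \<open>v\<close>, and the exempt index moves along
  with the start. Relating \<open>v\<close> and \<open>w\<close> by an equation instead of a formula
  for either lets the lemma serve both directions of the rotation bijection.\<close>

lemma Pcyc_rotate:
  assumes J: "J \<subseteq> {1..n}" and k: "k \<in> {1..n}" and w: "w \<in> {1..n} \<rightarrow>\<^sub>E {1..}"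
    and v: "v \<in> {1..n} \<rightarrow>\<^sub>E {1..}"
    and vw: "\<And>j. j \<in> {1..n} \<Longrightarrow> v (cyc_suc n j) = w j"
  shows "(v, cyc_suc n k) \<in> Pcyc n (cyc_suc n ` J) \<longleftrightarrow> (w, k) \<in> Pcyc n J"
proof -
  let ?s = "cyc_suc n"
  have inj: "inj_on ?s {1..n}" and img: "?s ` {1..n} = {1..n}"
    using bij_betw_cyc_suc by (auto simp: bij_betw_def)
  \<comment> \<open>Both \<open>cyc_pred n (?s k)\<close> and \<open>?s (cyc_pred n k)\<close> equal
    \<open>k\<close>, and an injective image commutes with removing a point.\<close>
  have shift: "?s ` A - {cyc_pred n (?s k)} = ?s ` (A - {cyc_pred n k})" if "A \<subseteq> {1..n}" for A
    using inj_on_image_set_diff[OF inj, of A "{cyc_pred n k}"] that k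
    by (simp add: cyc_pred_suc cyc_suc_pred cyc_pred_in subset_iff del: atLeastAtMost_iff One_nat_def)
  have 1: "(\<forall>j \<in> {1..n} - {cyc_pred n (?s k)}. v j \<le> v (?s j))
      \<longleftrightarrow> (\<forall>j \<in> {1..n} - {cyc_pred n k}. w j \<le> w (?s j))"
    using shift[of "{1..n}"] by (simp add: img vw cyc_suc_in del: atLeastAtMost_iff One_nat_def)
  have 2: "(\<forall>j \<in> ?s ` J - {cyc_pred n (?s k)}. v j < v (?s j))
      \<longleftrightarrow> (\<forall>j \<in> J - {cyc_pred n k}. w j < w (?s j))"
    using shift[OF J] J by (simp add: vw cyc_suc_in subset_iff del: atLeastAtMost_iff One_nat_def)
  show ?thesis
    unfolding Pcyc_def using 1 2 w v k cyc_suc_in[OF k] by blast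
qed

lemma card_cyc_words_rotate:
  assumes J: "J \<subseteq> {1..n}" and k: "k \<in> {1..n}"
  shows "card (cyc_words n (cyc_suc n ` J) (cyc_suc n k) m) = card (cyc_words n J k m)"
proof -
  let ?W = "{1..n} \<rightarrow>\<^sub>E {1::nat..}"
  have suc: "compose {1..n} w (cyc_suc n) \<in> ?W" if "w \<in> ?W" for w
    using that cyc_suc_in by (auto simp: compose_def PiE_iff)
  have pred: "compose {1..n} w (cyc_pred n) \<in> ?W" if "w \<in> ?W" for w
    using that cyc_pred_in by (auto simp: compose_def PiE_iff)
  have in_W: "w \<in> ?W" if "w \<in> cyc_words n J k m" for w J k
    using that by (simp add: cyc_words_def Pcyc_def)
  have "bij_betw (\<lambda>w. compose {1..n} w (cyc_pred n))
      (cyc_words n J k m) (cyc_words n (cyc_suc n ` J) (cyc_suc n k) m)"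
  proof (rule bij_betw_byWitness[where f' = "\<lambda>w. compose {1..n} w (cyc_suc n)"])
    show "\<forall>w\<in>cyc_words n J k m.
        compose {1..n} (compose {1..n} w (cyc_pred n)) (cyc_suc n) = w"
    proof
      fix w assume "w \<in> cyc_words n J k m"
      then have "w \<in> extensional {1..n}" using in_W by (auto simp: PiE_iff)
      then show "compose {1..n} (compose {1..n} w (cyc_pred n)) (cyc_suc n) = w"
        by (intro extensionalityI[of _ "{1..n}"])
          (simp_all add: compose_def cyc_suc_in cyc_pred_suc del: atLeastAtMost_iff One_nat_def)
    qed
    show "\<forall>w\<in>cyc_words n (cyc_suc n ` J) (cyc_suc n k) m.
        compose {1..n} (compose {1..n} w (cyc_suc n)) (cyc_pred n) = w"
    proof
      fix w assume "w \<in> cyc_words n (cyc_suc n ` J) (cyc_suc n k) m"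
      then have "w \<in> extensional {1..n}" using in_W by (auto simp: PiE_iff)
      then show "compose {1..n} (compose {1..n} w (cyc_suc n)) (cyc_pred n) = w"
        by (intro extensionalityI[of _ "{1..n}"])
          (simp_all add: compose_def cyc_pred_in cyc_suc_pred del: atLeastAtMost_iff One_nat_def)
    qed
    show "(\<lambda>w. compose {1..n} w (cyc_pred n)) ` cyc_words n J k m
        \<subseteq> cyc_words n (cyc_suc n ` J) (cyc_suc n k) m"
    proof (rule image_subsetI)
      fix w assume w: "w \<in> cyc_words n J k m"
      have "compose {1..n} w (cyc_pred n) (cyc_suc n j) = w j" if "j \<in> {1..n}" for j
        using that by (simp add: compose_def cyc_suc_in cyc_pred_suc del: atLeastAtMost_iff One_nat_def)
      from Pcyc_rotate[OF J k in_W[OF w] pred[OF in_W[OF w]] this]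
      show "compose {1..n} w (cyc_pred n) \<in> cyc_words n (cyc_suc n ` J) (cyc_suc n k) m"
        using w by (simp add: cyc_words_def image_mset_compose_bij bij_betw_cyc_pred del: One_nat_def)
    qed
    show "(\<lambda>w. compose {1..n} w (cyc_suc n)) ` cyc_words n (cyc_suc n ` J) (cyc_suc n k) m
        \<subseteq> cyc_words n J k m"
    proof (rule image_subsetI)
      fix w assume w: "w \<in> cyc_words n (cyc_suc n ` J) (cyc_suc n k) m"
      have "w (cyc_suc n j) = compose {1..n} w (cyc_suc n) j" if "j \<in> {1..n}" for j
        using that by (simp add: compose_def)
      \<comment> \<open>Now the given word plays the role of \<open>v\<close>, and its backward
        rotation that of \<open>w\<close>.\<close>
      from Pcyc_rotate[OF J k suc[OF in_W[OF w]] in_W[OF w] this]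
      show "compose {1..n} w (cyc_suc n) \<in> cyc_words n J k m"
        using w by (simp add: cyc_words_def image_mset_compose_bij bij_betw_cyc_suc del: One_nat_def)
    qed
  qed
  then show ?thesis by (simp add: bij_betw_same_card)
qed

section \<open>Summation over tableaux and starting positions\<close>

text \<open>Reindexing by \<open>p\<close> replaces each \<open>cD T\<close> by its rotation, and
  undoing the rotation lowers the start by one. Only the total over \<open>A\<close> is independent
  of \<open>k\<close>; for a single set the count can change with \<open>k\<close>.\<close>

lemma sum_cyc_words_indep:
  assumes ext: "cyclic_extension n A D cD p" and "1 \<le> k" "k \<le> n"
  shows "(\<Sum>T\<in>A. card (cyc_words n (cD T) k m)) = (\<Sum>T\<in>A. card (cyc_words n (cD T) 1 m))"
  using assms(2,3)
proof (induction k rule: dec_induct)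
  case (step k)
  have p: "bij_betw p A A" and cD: "\<And>T. T \<in> A \<Longrightarrow> cD (p T) = cyc_suc n ` cD T"
    "\<And>T. T \<in> A \<Longrightarrow> cD T \<subseteq> {1..n}"
    using ext by (auto simp: cyclic_extension_def)
  \<comment> \<open>In the induction step \<open>k < n\<close>, so the cyclic successor does not
    wrap around.\<close>
  have k: "k \<in> {1..n}" "Suc k = cyc_suc n k" using step by (auto simp: cyc_suc_def)
  have "(\<Sum>T\<in>A. card (cyc_words n (cD T) (Suc k) m))
      = (\<Sum>T\<in>A. card (cyc_words n (cD (p T)) (Suc k) m))"
    using sum.reindex_bij_betw[OF p, of "\<lambda>T. card (cyc_words n (cD T) (Suc k) m)"] by simp
  also have "\<dots> = (\<Sum>T\<in>A. card (cyc_words n (cD T) k m))"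
    unfolding k(2) using cD k(1) by (intro sum.cong) (simp_all add: card_cyc_words_rotate)
  finally show ?case using step by simp
qed simp

text \<open>The exempt index is \<open>cyc_pred n 1 = n\<close>, the only one where
  \<open>cyc_suc n\<close> wraps around, so all remaining comparisons are those of a linear
  word.\<close>

lemma cyc_words_1:
  assumes "n > 1" "J \<subseteq> {1..n}"
  shows "cyc_words n J 1 m =
    {u \<in> compatible_words n (J \<inter> {1..n - 1}). image_mset u (mset_set {1..n}) = m}"
proof -
  have "{1..n} - {n} = {1..<n}" "J \<inter> {1..n - 1} \<subseteq> {1..<n}"
    using assms(1) by auto
  moreover have "J - {n} = J \<inter> {1..n - 1}"
    using assms by (fastforce simp: subset_iff)
  moreover have "cyc_suc n j = Suc j" if "j \<in> {1..<n}" for j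
    using that by (auto simp: cyc_suc_def)
  ultimately have "(w, 1) \<in> Pcyc n J \<longleftrightarrow> w \<in> compatible_words n (J \<inter> {1..n - 1})" for w
    using assms(1) by (auto simp: Pcyc_def compatible_words_def cyc_pred_def subset_iff)
  then show ?thesis by (simp add: cyc_words_def)
qed

theorem theorem4p6:
  fixes lam mu :: "nat \<Rightarrow> nat"
    and n :: nat
    and cDes :: "(cell \<Rightarrow> nat) \<Rightarrow> nat set"
    and p :: "(cell \<Rightarrow> nat) \<Rightarrow> (cell \<Rightarrow> nat)"
  assumes "is_partition lam" and "is_partition mu" and "mu \<le> lam"
    and "card (skew_shape lam mu) = n"
    and "\<not> (connected_shape (skew_shape lam mu) \<and> ribbon (skew_shape lam mu))"
    and "cyclic_extension n (SYT (skew_shape lam mu)) (Des (skew_shape lam mu)) cDes p"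
  shows "(\<lambda>m. int n * skew_schur lam mu m) =
         (\<lambda>m. \<Sum>T\<in>SYT (skew_shape lam mu). Fcyc n (cDes T) m)"
proof
  fix m
  let ?D = "skew_shape lam mu"
  note ext = assms(6)
  have n: "n > 1" and cDes: "\<And>T. T \<in> SYT ?D \<Longrightarrow> cDes T \<inter> {1..n - 1} = Des ?D T"
    "\<And>T. T \<in> SYT ?D \<Longrightarrow> cDes T \<subseteq> {1..n}"
    using ext by (auto simp: cyclic_extension_def)
  \<comment> \<open>With start 1 only \<open>cDes T\<close> inside \<open>{1..n - 1}\<close>
    matters, which is \<open>Des ?D T\<close>; these are the words that standardization pairs with
    \<open>T\<close>.\<close>
  have start_1: "(\<Sum>T\<in>SYT ?D. card (cyc_words n (cDes T) 1 m))
      = card {S \<in> SSYT ?D. image_mset S (mset_set ?D) = m}"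
    unfolding card_SSYT_content[OF finite_skew_shape[OF assms(1)]] assms(4)
    using cDes by (intro sum.cong refl) (simp only: cyc_words_1[OF n])
  have "(\<Sum>T\<in>SYT ?D. Fcyc n (cDes T) m)
      = (\<Sum>k\<in>{1..n}. int (\<Sum>T\<in>SYT ?D. card (cyc_words n (cDes T) k m)))"
    unfolding Fcyc_eq_sum of_nat_sum by (rule sum.swap)
  \<comment> \<open>Each of the \<open>n\<close> starts contributes the same Schur coefficient,
    whence the factor \<open>n\<close>.\<close>
  also have "\<dots> = (\<Sum>k\<in>{1..n}. int (card {S \<in> SSYT ?D. image_mset S (mset_set ?D) = m}))"
    by (intro sum.cong refl arg_cong[of _ _ int] trans[OF sum_cyc_words_indep[OF ext] start_1]) auto
  also have "\<dots> = int n * skew_schur lam mu m"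
    by (simp add: skew_schur_def gen_series_def)
  finally show "int n * skew_schur lam mu m = (\<Sum>T\<in>SYT ?D. Fcyc n (cDes T) m)" ..
qed

end
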